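(* Let $Y\in\mathbb{R}^{n\times p}$, $f(x)=\|Y^\top x\|_1$, and $\mathcal{M}=\{x\in\mathbb{R}^n : \|x\|_2=1\}$, and consider the problem $\min_{x\in\mathcal{M}} f(x)$. Let $\{x^k\}_{k\ge 0}$ be a sequence generated by the ManPPA algorithm (described in the context) with initial point $x^0\in\mathcal{M}$, line-search parameter $\beta\in(0,1)$ and proximal parameter $t>0$. Then every limit point of $\{x^k\}_k$ is a stationary point of the problem. Moreover, for every $\epsilon>0$, ManPPA with $t=1/L$ returns an $\epsilon$-stationary point within at most $\lceil 2(f(x^0)-f^* )/(L\epsilon^2)\rceil$ iterations, i.e., there is $k\le \lceil 2(f(x^0)-f^* )/(L\epsilon^2)\rceil$ such that $x^k$ is an $\epsilon$-stationary point, where $f^*=\min_{x\in\mathcal{M}} f(x)$.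
   Context: $L>0$ denotes the Lipschitz constant of $f$, i.e., $|f(x)-f(y)|\le L\|x-y\|_2$ for all $x,y\in\mathbb{R}^n$. $\mathrm{Proj}_{\mathcal{M}}$ denotes projection onto $\mathcal{M}$, so $\mathrm{Proj}_{\mathcal{M}}(x)=x/\|x\|_2$ for $x\neq 0$. ManPPA algorithm. Input: $x^0\in\mathcal{M}$, $\beta\in(0,1)$, $t>0$. For $k=0,1,2,\dots$: (1) let $d^k$ be the unique solution of $$\min_{d\in\mathbb{R}^n}\ \|Y^\top(x^k+d)\|_1+\frac{1}{2t}\|d\|_2^2\quad\text{s.t.}\quad d^\top x^k=0;$$ (2) let $j_k$ be the smallest nonnegative integer such that $f(\mathrm{Proj}_{\mathcal{M}}(x^k+\beta^{j_k}d^k))\le f(x^k)-\frac{\beta^{j_k}}{2t}\|d^k\|_2^2$; (3) set $\alpha_k=\beta^{j_k}$ and $x^{k+1}=\mathrm{Proj}_{\mathcal{M}}(x^k+\alpha_k d^k)$. A point $\bar x\in\mathcal{M}$ is a stationary point of the problem if $0\in(I_n-\bar x\bar x^\top)\partial f(\bar x)$, where $\partial f$ is the convex subdifferential. An iterate $x^k\in\mathcal{M}$ is called an $\epsilon$-stationary point if the corresponding $d^k$ from step (1) satisfies $\|d^k\|_2\le\epsilon$. *)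

theory Defs
  imports "HOL-Analysis.Analysis"
begin

definition l1_norm :: "real ^ 'n \<Rightarrow> real" where
  "l1_norm v = (\<Sum>i\<in>UNIV. \<bar>v $ i\<bar>)"

definition objective :: "real ^ 'p ^ 'n \<Rightarrow> real ^ 'n \<Rightarrow> real" where
  "objective Y x = l1_norm (transpose Y *v x)"

definition unit_sphere :: "(real ^ 'n) set" where
  "unit_sphere = {x. norm x = 1}"

text \<open>Off the origin the closest point is unique, namely \<open>x /\<^sub>R norm x\<close>; at the origin
  \<^const>\<open>closest_point\<close> picks an arbitrary point of the sphere.\<close>

definition proj_sphere :: "real ^ 'n \<Rightarrow> real ^ 'n" where
  "proj_sphere x = closest_point unit_sphere x"

definition subdifferential :: "('a::real_inner \<Rightarrow> real) \<Rightarrow> 'a \<Rightarrow> 'a set" where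
  "subdifferential f x = {g. \<forall>y. f y \<ge> f x + g \<bullet> (y - x)}"

text \<open>In the outer product, the type annotation fixes the inner dimension to 1: \<^const>\<open>columnvector\<close>
  by itself allows any number of equal columns.\<close>

definition stationary_point :: "real ^ 'p ^ 'n \<Rightarrow> real ^ 'n \<Rightarrow> bool" where
  "stationary_point Y x \<longleftrightarrow> x \<in> unit_sphere \<and>
     0 \<in> (\<lambda>g. (mat 1 - (columnvector x :: real ^ 1 ^ 'n) ** rowvector x) *v g) ` subdifferential (objective Y) x"

text \<open>The algorithm is rendered by total functions: the description \<^term>\<open>The\<close> below denotes a
  minimizer only where the minimizer exists and is unique, and \<^term>\<open>Least\<close> denotes an accepted
  step only where some step is accepted. Neither property is assumed anywhere.\<close>

definition manppa_dir :: "real ^ 'p ^ 'n \<Rightarrow> real \<Rightarrow> real ^ 'n \<Rightarrow> real ^ 'n" where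
  "manppa_dir Y t x =
     (THE d. is_arg_min (\<lambda>d. l1_norm (transpose Y *v (x + d)) + 1 / (2 * t) * (norm d)\<^sup>2)
               (\<lambda>d. d \<bullet> x = 0) d)"

definition manppa_ls :: "real ^ 'p ^ 'n \<Rightarrow> real \<Rightarrow> real \<Rightarrow> real ^ 'n \<Rightarrow> nat" where
  "manppa_ls Y \<beta> t x =
     (LEAST j. objective Y (proj_sphere (x + \<beta> ^ j *\<^sub>R manppa_dir Y t x))
                 \<le> objective Y x - \<beta> ^ j / (2 * t) * (norm (manppa_dir Y t x))\<^sup>2)"

definition manppa_step :: "real ^ 'p ^ 'n \<Rightarrow> real \<Rightarrow> real \<Rightarrow> real ^ 'n \<Rightarrow> real ^ 'n" where
  "manppa_step Y \<beta> t x = proj_sphere (x + \<beta> ^ manppa_ls Y \<beta> t x *\<^sub>R manppa_dir Y t x)"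

definition manppa_sequence ::
    "real ^ 'p ^ 'n \<Rightarrow> real \<Rightarrow> real \<Rightarrow> (nat \<Rightarrow> real ^ 'n) \<Rightarrow> bool" where
  "manppa_sequence Y \<beta> t x \<longleftrightarrow>
     x 0 \<in> unit_sphere \<and> (\<forall>k. x (Suc k) = manppa_step Y \<beta> t (x k))"

definition eps_stationary_point ::
    "real ^ 'p ^ 'n \<Rightarrow> real \<Rightarrow> real \<Rightarrow> real ^ 'n \<Rightarrow> bool" where
  "eps_stationary_point Y t \<epsilon> x \<longleftrightarrow> x \<in> unit_sphere \<and> norm (manppa_dir Y t x) \<le> \<epsilon>"

text \<open>The infimum of a continuous function on a nonempty compact set, hence the minimum.\<close>

definition optimal_value :: "real ^ 'p ^ 'n \<Rightarrow> real" where
  "optimal_value Y = (INF x\<in>unit_sphere. objective Y x)"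

definition sequence_limit_point :: "(nat \<Rightarrow> 'a::topological_space) \<Rightarrow> 'a \<Rightarrow> bool" where
  "sequence_limit_point x l \<longleftrightarrow> (\<exists>r. strict_mono r \<and> (x \<circ> r) \<longlonglongrightarrow> l)"

end

theory Submission
  imports Defs
begin

text \<open>Comparing the minimizer \<open>d\<close> of the subproblem at \<open>x\<close> with the feasible point \<open>0\<close>
  gives \<open>f (x + d) + \<parallel>d\<parallel>\<^sup>2 / (2t) \<le> f x\<close>. Since \<open>d\<close> is orthogonal to \<open>x\<close>, the norm of \<open>x + d\<close> is
  at least \<open>1\<close>, and \<open>f\<close> is nonnegative and positively homogeneous, so normalizing \<open>x + d\<close> does
  not increase \<open>f\<close>. Hence the unit step is always accepted, for every \<open>t\<close>; summing the decrease
  gives both the complexity bound and \<open>d\<^sup>k \<rightarrow> 0\<close>.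

  At a limit point \<open>l\<close>, passing to the limit in the optimality of \<open>d\<^sup>k\<close> and using convexity yields
  \<open>f l \<le> f (l + d)\<close> for all \<open>d\<close> orthogonal to \<open>l\<close>. By homogeneity this says exactly that \<open>f l\<close>
  times \<open>l\<close>, which is normal to the sphere, is a subgradient of \<open>f\<close> at \<open>l\<close>.\<close>

section \<open>Projection onto the sphere\<close>

text \<open>On the sphere the squared distance to \<open>y\<close> depends on \<open>w\<close> only
  through \<open>y \<bullet> w\<close>, so a closest point maximizes this inner product. The
  equality case of Cauchy-Schwarz then forces it onto the ray of \<open>y\<close>.\<close>

lemma closest_point_unit_sphere:
  fixes y :: "'a::euclidean_space"
  assumes "y \<noteq> 0"
  shows "closest_point {z. norm z = 1} y = y /\<^sub>R norm y"
proof -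
  define S :: "'a set" where "S = {z. norm z = 1}"
  define z where "z = closest_point S y"
  have S: "S = sphere 0 1" by (auto simp: S_def)
  have "closed S" by (simp add: S)
  moreover have u: "y /\<^sub>R norm y \<in> S" using assms by (simp add: S_def)
  ultimately have zS: "z \<in> S" and le: "dist y z \<le> dist y (y /\<^sub>R norm y)"
    unfolding z_def by (auto intro: closest_point_in_set closest_point_le)
  have *: "(dist y w)\<^sup>2 = (norm y)\<^sup>2 - 2 * (y \<bullet> w) + 1" if "w \<in> S" for w
  proof -
    have "w \<bullet> w = 1" using that by (simp add: S_def dot_square_norm)
    then show ?thesis
      by (simp add: dist_norm power2_norm_eq_inner inner_diff inner_commute algebra_simps)
  qed
  have "y \<bullet> (y /\<^sub>R norm y) = norm y"
    using assms by (simp add: dot_square_norm power2_eq_square)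
  moreover have "(dist y z)\<^sup>2 \<le> (dist y (y /\<^sub>R norm y))\<^sup>2"
    using le by (intro power_mono) auto
  ultimately have "norm y \<le> y \<bullet> z" using *[OF zS] *[OF u] by simp
  moreover have nz: "norm z = 1" using zS by (simp add: S_def)
  moreover have "y \<bullet> z \<le> norm y * norm z" by (rule norm_cauchy_schwarz)
  ultimately have "y \<bullet> z = norm y * norm z" by simp
  then have "norm y *\<^sub>R z = norm z *\<^sub>R y" by (simp only: norm_cauchy_schwarz_eq)
  then have "y = norm y *\<^sub>R z" using nz by simp
  then have "y /\<^sub>R norm y = (norm y *\<^sub>R z) /\<^sub>R norm y" by simp
  then have "z = y /\<^sub>R norm y" using assms by simp
  then show ?thesis by (simp add: z_def S_def)
qed

lemma proj_sphere_eq: "y \<noteq> 0 \<Longrightarrow> proj_sphere y = y /\<^sub>R norm y"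
  unfolding proj_sphere_def unit_sphere_def by (rule closest_point_unit_sphere)

section \<open>Well-posedness of the proximal subproblem\<close>

lemma ex1_prox_minimizer:
  fixes f :: "'a::euclidean_space \<Rightarrow> real"
  assumes "convex_on UNIV f" and nonneg: "\<And>d. 0 \<le> f d" and "0 < c" and S: "subspace S"
  shows "\<exists>!d. is_arg_min (\<lambda>d. f d + c * (norm d)\<^sup>2) (\<lambda>d. d \<in> S) d"
proof -
  define G where "G = (\<lambda>d. f d + c * (norm d)\<^sup>2)"
  \<comment> \<open>The radius solves \<open>c * R\<^sup>2 = f 0\<close>: outside this ball the
    quadratic term alone reaches the value \<open>G 0\<close>, so minimizing over the ball
    suffices.\<close>
  define R where "R = sqrt (f 0 / c)"
  have R0: "R \<ge> 0" using \<open>0 < c\<close> nonneg by (simp add: R_def)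
  have "continuous_on UNIV f"
    using assms(1) by (intro convex_on_continuous) auto
  then have "continuous_on (S \<inter> cball 0 R) G"
    unfolding G_def by (intro continuous_intros) (auto intro: continuous_on_subset)
  moreover have "compact (S \<inter> cball 0 R)"
    by (intro closed_Int_compact closed_subspace S compact_cball)
  moreover have zero: "0 \<in> S \<inter> cball 0 R"
    using R0 S by (simp add: subspace_0)
  ultimately obtain d where d: "d \<in> S \<inter> cball 0 R" and dmin: "\<And>e. e \<in> S \<inter> cball 0 R \<Longrightarrow> G d \<le> G e"
    using continuous_attains_inf[of "S \<inter> cball 0 R" G] by blast
  have dmin': "G d \<le> G e" if "e \<in> S" for e
  proof (cases "norm e \<le> R")
    case True
    then show ?thesis using dmin that by simp
  next
    case False
    then have "R\<^sup>2 \<le> (norm e)\<^sup>2" using R0 by (intro power_mono) auto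
    then have "f 0 \<le> c * (norm e)\<^sup>2"
      using \<open>0 < c\<close> nonneg[of 0] by (simp add: R_def field_simps)
    then have "G 0 \<le> G e" using nonneg[of e] by (simp add: G_def)
    then show ?thesis using dmin[OF zero] by simp
  qed
  have "e = d" if "e \<in> S" "\<And>b. b \<in> S \<Longrightarrow> G e \<le> G b" for e
  proof -
    \<comment> \<open>Strong convexity tested at the midpoint: it beats the average of the two
      minimal values by at least \<open>c / 4 * (norm (e - d))\<^sup>2\<close>, which must therefore
      vanish.\<close>
    let ?m = "(1/2) *\<^sub>R e + (1/2) *\<^sub>R d"
    have "?m \<in> S" using that d S by (auto intro: subspace_add subspace_scale)
    then have "G d \<le> G ?m" "G e \<le> G ?m" using dmin' that by auto
    moreover have "f ?m \<le> (1/2) * f e + (1/2) * f d"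
      using convex_onD[OF assms(1), of "1/2" e d] by simp
    moreover have "(norm ?m)\<^sup>2 = (1/2) * (norm e)\<^sup>2 + (1/2) * (norm d)\<^sup>2 - (1/4) * (norm (e - d))\<^sup>2"
      by (simp add: power2_norm_eq_inner inner_simps inner_commute algebra_simps)
    then have "c * (norm ?m)\<^sup>2 =
        (1/2) * (c * (norm e)\<^sup>2) + (1/2) * (c * (norm d)\<^sup>2) - (1/4) * (c * (norm (e - d))\<^sup>2)"
      by (simp only:) (simp add: right_diff_distrib distrib_left)
    ultimately have "c * (norm (e - d))\<^sup>2 \<le> 0"
      unfolding G_def by linarith
    then show ?thesis using \<open>0 < c\<close> by (simp add: mult_le_0_iff)
  qed
  then show ?thesis
    using d dmin' unfolding is_arg_min_linorder G_def by blast
qed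

section \<open>The objective as a seminorm\<close>

lemma objective_nonneg: "0 \<le> objective Y x"
  by (simp add: objective_def l1_norm_def sum_nonneg)

lemma objective_scaleR: "objective Y (c *\<^sub>R x) = \<bar>c\<bar> * objective Y x"
  by (simp add: objective_def l1_norm_def matrix_vector_mult_scaleR abs_mult sum_distrib_left)

lemma objective_triangle: "objective Y (x + y) \<le> objective Y x + objective Y y"
  by (simp add: objective_def l1_norm_def matrix_vector_right_distrib flip: sum.distrib)
     (intro sum_mono abs_triangle_ineq)

lemma convex_on_objective: "convex_on UNIV (objective Y)"
proof (rule convex_onI)
  fix s :: real and x y
  assume "0 < s" "s < 1"
  then show "objective Y ((1 - s) *\<^sub>R x + s *\<^sub>R y) \<le> (1 - s) * objective Y x + s * objective Y y"
    using objective_triangle[of Y "(1 - s) *\<^sub>R x" "s *\<^sub>R y"] by (simp add: objective_scaleR)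
qed simp

lemma continuous_on_objective: "continuous_on UNIV (objective Y)"
  by (rule convex_on_continuous[OF _ convex_on_objective]) simp

text \<open>Justifies the definite description in \<open>manppa_dir\<close> at every
  \<open>x\<close>: the feasible set is a subspace and the shifted objective is convex and
  nonnegative.\<close>

lemma is_arg_min_manppa_dir:
  assumes "0 < t"
  shows "is_arg_min (\<lambda>d. l1_norm (transpose Y *v (x + d)) + 1 / (2 * t) * (norm d)\<^sup>2)
           (\<lambda>d. d \<bullet> x = 0) (manppa_dir Y t x)"
proof -
  have "convex_on UNIV (\<lambda>d. objective Y (x + d))"
  proof (rule convex_onI)
    fix s :: real and d e
    assume "0 < s" "s < 1"
    moreover have "x + ((1 - s) *\<^sub>R d + s *\<^sub>R e) = (1 - s) *\<^sub>R (x + d) + s *\<^sub>R (x + e)"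
      by (simp add: algebra_simps)
    ultimately show "objective Y (x + ((1 - s) *\<^sub>R d + s *\<^sub>R e))
        \<le> (1 - s) * objective Y (x + d) + s * objective Y (x + e)"
      using convex_onD[OF convex_on_objective, of s "x + d" "x + e"] by simp
  qed simp
  moreover have "subspace {d. d \<bullet> x = 0}"
    by (simp add: subspace_def inner_simps)
  ultimately have "\<exists>!d. is_arg_min (\<lambda>d. objective Y (x + d) + 1 / (2 * t) * (norm d)\<^sup>2)
      (\<lambda>d. d \<in> {d. d \<bullet> x = 0}) d"
    using assms by (intro ex1_prox_minimizer objective_nonneg) auto
  then show ?thesis
    unfolding manppa_dir_def objective_def mem_Collect_eq by (rule theI')
qed

lemma manppa_dir_orthogonal: "0 < t \<Longrightarrow> manppa_dir Y t x \<bullet> x = 0"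
  using is_arg_min_manppa_dir[of t Y x] by (simp add: is_arg_min_linorder)

lemma manppa_dir_optimal:
  assumes "0 < t" "d \<bullet> x = 0"
  shows "objective Y (x + manppa_dir Y t x) + (norm (manppa_dir Y t x))\<^sup>2 / (2 * t)
    \<le> objective Y (x + d) + (norm d)\<^sup>2 / (2 * t)"
  using is_arg_min_manppa_dir[of t Y x] assms by (simp add: is_arg_min_linorder objective_def)

section \<open>Acceptance of the unit step and descent\<close>

lemma norm_add_orthogonal_ge_1:
  fixes x :: "'a::real_inner"
  assumes "norm x = 1" "d \<bullet> x = 0"
  shows "1 \<le> norm (x + d)"
proof -
  have "(norm (x + d))\<^sup>2 = 1 + (norm d)\<^sup>2"
    using assms by (subst norm_add_Pythagorean) (auto simp: orthogonal_def inner_commute)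
  then show ?thesis by (intro power2_le_imp_le[of 1]) auto
qed

lemma objective_proj_sphere_le:
  assumes "1 \<le> norm y"
  shows "objective Y (proj_sphere y) \<le> objective Y y"
proof -
  have "y \<noteq> 0" using assms by auto
  moreover have "inverse (norm y) \<le> 1" using assms by (simp add: inverse_le_1_iff)
  ultimately show ?thesis
    using mult_right_mono[OF _ objective_nonneg, of "inverse (norm y)" 1 Y y]
    by (simp add: proj_sphere_eq objective_scaleR)
qed

lemma unit_step_accepted:
  assumes "0 < t" "x \<in> unit_sphere"
  shows "objective Y (proj_sphere (x + manppa_dir Y t x))
    \<le> objective Y x - (norm (manppa_dir Y t x))\<^sup>2 / (2 * t)"
proof -
  have "1 \<le> norm (x + manppa_dir Y t x)"
    using assms by (intro norm_add_orthogonal_ge_1 manppa_dir_orthogonal) (auto simp: unit_sphere_def)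
  from objective_proj_sphere_le[OF this, of Y] show ?thesis
    using manppa_dir_optimal[OF assms(1), of 0 x Y] by simp
qed

text \<open>Exponent \<open>0\<close> already passes the line-search test, so the
  \<open>LEAST\<close> in \<open>manppa_ls\<close> is \<open>0\<close> and backtracking never
  occurs.\<close>

lemma manppa_step_eq:
  assumes "0 < t" "x \<in> unit_sphere"
  shows "manppa_step Y \<beta> t x = proj_sphere (x + manppa_dir Y t x)"
proof -
  have "manppa_ls Y \<beta> t x = 0"
    unfolding manppa_ls_def
    using unit_step_accepted[OF assms] by (intro Least_eq_0) simp
  then show ?thesis by (simp add: manppa_step_def)
qed

lemma proj_sphere_in_unit_sphere: "y \<noteq> 0 \<Longrightarrow> proj_sphere y \<in> unit_sphere"
  by (simp add: proj_sphere_eq unit_sphere_def)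

lemma manppa_sequence_in_unit_sphere:
  assumes "0 < t" "manppa_sequence Y \<beta> t x"
  shows "x k \<in> unit_sphere"
proof (induction k)
  case 0
  then show ?case using assms by (simp add: manppa_sequence_def)
next
  case (Suc k)
  then have "1 \<le> norm (x k + manppa_dir Y t (x k))"
    using assms by (intro norm_add_orthogonal_ge_1 manppa_dir_orthogonal) (auto simp: unit_sphere_def)
  then have "x k + manppa_dir Y t (x k) \<noteq> 0" by auto
  with Suc show ?case
    using assms by (simp add: manppa_sequence_def manppa_step_eq proj_sphere_in_unit_sphere)
qed

text \<open>Telescopes the decrease guaranteed by each unit step.\<close>

lemma manppa_sequence_sum_le:
  assumes "0 < t" "manppa_sequence Y \<beta> t x"
  shows "(\<Sum>k<m. (norm (manppa_dir Y t (x k)))\<^sup>2) / (2 * t) \<le> objective Y (x 0) - objective Y (x m)"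
proof (induction m)
  case (Suc m)
  have "objective Y (x (Suc m)) \<le> objective Y (x m) - (norm (manppa_dir Y t (x m)))\<^sup>2 / (2 * t)"
    using unit_step_accepted[OF assms(1) manppa_sequence_in_unit_sphere[OF assms]] assms
    by (simp add: manppa_sequence_def manppa_step_eq manppa_sequence_in_unit_sphere[OF assms])
  with Suc show ?case by (simp add: add_divide_distrib)
qed simp

lemma manppa_dir_tendsto_0:
  assumes "0 < t" "manppa_sequence Y \<beta> t x"
  shows "(\<lambda>k. manppa_dir Y t (x k)) \<longlonglongrightarrow> 0"
proof -
  have "summable (\<lambda>k. (norm (manppa_dir Y t (x k)))\<^sup>2)"
  proof (rule summableI_nonneg_bounded)
    fix m
    have "(\<Sum>k<m. (norm (manppa_dir Y t (x k)))\<^sup>2) / (2 * t) \<le> objective Y (x 0)"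
      using manppa_sequence_sum_le[OF assms, of m] objective_nonneg[of Y "x m"] by linarith
    then show "(\<Sum>k<m. (norm (manppa_dir Y t (x k)))\<^sup>2) \<le> objective Y (x 0) * (2 * t)"
      using assms(1) by (simp add: pos_divide_le_eq)
  qed simp
  then have "(\<lambda>k. (norm (manppa_dir Y t (x k)))\<^sup>2) \<longlonglongrightarrow> 0"
    by (rule summable_LIMSEQ_zero)
  then have "(\<lambda>k. sqrt ((norm (manppa_dir Y t (x k)))\<^sup>2)) \<longlonglongrightarrow> sqrt 0"
    by (rule tendsto_real_sqrt)
  then show ?thesis by (simp add: tendsto_norm_zero_iff)
qed

section \<open>Stationarity of limit points\<close>

text \<open>Along \<open>s *\<^sub>R d\<close> the penalty is of order \<open>s\<^sup>2\<close>,
  while convexity would make any decrease at least linear in \<open>s\<close>. Dividing by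
  \<open>s\<close> and letting it tend to \<open>0\<close> removes the penalty.\<close>

lemma convex_le_of_le_add_norm_square:
  fixes f :: "'a::real_normed_vector \<Rightarrow> real"
  assumes "convex_on UNIV f" and "subspace S" and d: "d \<in> S"
    and le: "\<And>e. e \<in> S \<Longrightarrow> f l \<le> f (l + e) + c * (norm e)\<^sup>2"
  shows "f l \<le> f (l + d)"
proof -
  have *: "f l - f (l + d) \<le> s * (c * (norm d)\<^sup>2)" if "0 < s" "s \<le> 1" for s :: real
  proof -
    have "f l \<le> f (l + s *\<^sub>R d) + c * (norm (s *\<^sub>R d))\<^sup>2"
      using assms(2) d by (intro le subspace_scale)
    also have "l + s *\<^sub>R d = (1 - s) *\<^sub>R l + s *\<^sub>R (l + d)" by (simp add: algebra_simps)
    also have "f \<dots> \<le> (1 - s) * f l + s * f (l + d)"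
      using convex_onD[OF assms(1), of s l "l + d"] that by simp
    finally have "s * (f l - f (l + d)) \<le> s * (s * (c * (norm d)\<^sup>2))"
      by (simp add: power_mult_distrib power2_eq_square algebra_simps)
    then show ?thesis using that by simp
  qed
  have "((\<lambda>s. s * (c * (norm d)\<^sup>2)) \<longlongrightarrow> 0 * (c * (norm d)\<^sup>2)) (at_right 0)"
    by (intro tendsto_intros)
  moreover have "\<forall>\<^sub>F s in at_right (0::real). f l - f (l + d) \<le> s * (c * (norm d)\<^sup>2)"
    using * by (auto simp: eventually_at_right_field intro!: exI[of _ 1])
  ultimately have "f l - f (l + d) \<le> 0 * (c * (norm d)\<^sup>2)"
    by (intro tendsto_lowerbound) auto
  then show ?thesis by simp
qed

lemma objective_le_tangent:
  fixes Y :: "real ^ 'p ^ 'n"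
  assumes "0 < t" "manppa_sequence Y \<beta> t x" and lim: "(x \<circ> r) \<longlonglongrightarrow> l" and r: "strict_mono r"
    and "l \<in> unit_sphere" and d: "d \<bullet> l = 0"
  shows "objective Y l \<le> objective Y (l + d)"
proof (rule convex_le_of_le_add_norm_square[OF convex_on_objective])
  show "subspace {e. e \<bullet> l = 0}" by (simp add: subspace_def inner_simps)
  show "d \<in> {e. e \<bullet> l = 0}" using d by simp
  fix e assume "e \<in> {e. e \<bullet> l = 0}"
  then have e: "e \<bullet> l = 0" by simp
  define X where "X = (\<lambda>k. x (r k))"
  define D where "D = (\<lambda>k. manppa_dir Y t (X k))"
  \<comment> \<open>The direction \<open>e\<close> is tangent at \<open>l\<close> but generally not
    at \<open>X k\<close>. Projecting it onto the tangent space there gives a feasible competitor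
    for \<open>D k\<close>, and these projections converge back to \<open>e\<close>.\<close>
  define E where "E = (\<lambda>k. e - (e \<bullet> X k) *\<^sub>R X k)"
  have X: "X \<longlonglongrightarrow> l" using lim by (simp add: X_def comp_def)
  have D: "D \<longlonglongrightarrow> 0"
    using LIMSEQ_subseq_LIMSEQ[OF manppa_dir_tendsto_0[OF assms(1,2)] r]
    by (simp add: D_def X_def comp_def)
  have "E \<longlonglongrightarrow> e - (e \<bullet> l) *\<^sub>R l"
    unfolding E_def by (intro tendsto_intros X)
  then have E: "E \<longlonglongrightarrow> e" using e by simp
  have cont: "(\<lambda>k. objective Y (u k)) \<longlonglongrightarrow> objective Y v" if "u \<longlonglongrightarrow> v" for u v
    using continuous_on_tendsto_compose[OF continuous_on_objective that] by simp
  have "E k \<bullet> X k = 0" for k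
    using manppa_sequence_in_unit_sphere[OF assms(1,2), of "r k"]
    by (simp add: E_def X_def inner_simps dot_square_norm unit_sphere_def)
  then have le: "objective Y (X k + D k) + (norm (D k))\<^sup>2 / (2 * t)
      \<le> objective Y (X k + E k) + (norm (E k))\<^sup>2 / (2 * t)" for k
    unfolding D_def by (intro manppa_dir_optimal assms(1))
  have L: "(\<lambda>k. objective Y (X k + D k) + (norm (D k))\<^sup>2 / (2 * t))
      \<longlonglongrightarrow> objective Y (l + 0) + (norm (0 :: real ^ 'n))\<^sup>2 / (2 * t)"
    using assms(1) by (intro tendsto_intros cont X D) auto
  have "(\<lambda>k. objective Y (X k + E k) + (norm (E k))\<^sup>2 / (2 * t))
      \<longlonglongrightarrow> objective Y (l + e) + (norm e)\<^sup>2 / (2 * t)"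
    using assms(1) by (intro tendsto_intros cont X E) auto
  from LIMSEQ_le[OF L this] le show "objective Y l \<le> objective Y (l + e) + 1 / (2 * t) * (norm e)\<^sup>2"
    by auto
qed

text \<open>Shows that for a unit vector the matrix in \<open>stationary_point\<close> is the
  orthogonal projection onto the tangent space, which annihilates every multiple of
  \<open>x\<close>.\<close>

lemma outer_product_mult_vector:
  fixes x g :: "real ^ 'n"
  shows "((columnvector x :: real ^ 1 ^ 'n) ** rowvector x) *v g = (x \<bullet> g) *\<^sub>R x"
  by (simp add: vec_eq_iff matrix_vector_mult_def matrix_matrix_mult_def columnvector_def
      rowvector_def inner_vec_def sum_distrib_left mult_ac)

text \<open>The witness is the subgradient \<open>objective Y l *\<^sub>R l\<close>. Since
  \<open>l \<bullet> l = 1\<close>, the constant terms of its subgradient inequality cancel, leaving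
  \<open>objective Y l * (l \<bullet> y) \<le> objective Y y\<close>.\<close>

lemma stationary_point_if_le_tangent:
  fixes Y :: "real ^ 'p ^ 'n"
  assumes l: "l \<in> unit_sphere" and le: "\<And>d. d \<bullet> l = 0 \<Longrightarrow> objective Y l \<le> objective Y (l + d)"
  shows "stationary_point Y l"
proof -
  have ll: "l \<bullet> l = 1" using l by (simp add: unit_sphere_def dot_square_norm)
  have "objective Y l * (l \<bullet> y) \<le> objective Y y" for y
  proof (cases "l \<bullet> y \<le> 0")
    case True
    then show ?thesis
      using mult_nonneg_nonpos[OF objective_nonneg True, of Y l] objective_nonneg[of Y y] by linarith
  next
    case False
    \<comment> \<open>Dividing \<open>y\<close> by \<open>s\<close> moves it into the affine tangent
      hyperplane through \<open>l\<close>, where the hypothesis applies; homogeneity scales the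
      result back.\<close>
    define s where "s = l \<bullet> y"
    define d where "d = y /\<^sub>R s - l"
    have s: "0 < s" using False by (simp add: s_def)
    have "d \<bullet> l = 0" using s ll by (simp add: d_def inner_simps inner_commute flip: s_def)
    then have "objective Y l * s \<le> objective Y (l + d) * s"
      using s by (intro mult_right_mono le) auto
    also have "\<dots> = objective Y y" using s by (simp add: d_def objective_scaleR)
    finally show ?thesis by (simp add: s_def)
  qed
  then have "objective Y l *\<^sub>R l \<in> subdifferential (objective Y) l"
    using ll by (simp add: subdifferential_def inner_simps algebra_simps)
  moreover have "(mat 1 - (columnvector l :: real ^ 1 ^ 'n) ** rowvector l) *v (objective Y l *\<^sub>R l) = 0"
    using ll by (simp add: matrix_vector_mult_diff_rdistrib outer_product_mult_vector)
  ultimately show ?thesis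
    using l unfolding stationary_point_def by (metis image_eqI)
qed

lemma limit_point_stationary:
  assumes "0 < t" "manppa_sequence Y \<beta> t x" "sequence_limit_point x l"
  shows "stationary_point Y l"
proof -
  obtain r where r: "strict_mono r" "(x \<circ> r) \<longlonglongrightarrow> l"
    using assms(3) by (auto simp: sequence_limit_point_def)
  from tendsto_norm[OF r(2)] have "(\<lambda>k. 1) \<longlonglongrightarrow> norm l"
    using manppa_sequence_in_unit_sphere[OF assms(1,2)] by (simp add: unit_sphere_def)
  then have "l \<in> unit_sphere"
    by (simp add: unit_sphere_def LIMSEQ_const_iff)
  then show ?thesis
    using objective_le_tangent[OF assms(1,2) r(2,1)] by (intro stationary_point_if_le_tangent)
qed

section \<open>Iteration complexity\<close>

lemma optimal_value_le: "x \<in> unit_sphere \<Longrightarrow> optimal_value Y \<le> objective Y x"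
  unfolding optimal_value_def by (intro cINF_lower bdd_belowI2[of _ 0] objective_nonneg)

lemma ex_eps_stationary_point:
  assumes "0 < t" "manppa_sequence Y \<beta> t x" "0 < \<epsilon>"
  shows "\<exists>k. int k \<le> \<lceil>2 * t * (objective Y (x 0) - optimal_value Y) / \<epsilon>\<^sup>2\<rceil> \<and>
    eps_stationary_point Y t \<epsilon> (x k)"
proof (rule ccontr)
  define B where "B = 2 * t * (objective Y (x 0) - optimal_value Y) / \<epsilon>\<^sup>2"
  define m where "m = nat \<lceil>B\<rceil>"
  note sph = manppa_sequence_in_unit_sphere[OF assms(1,2)]
  assume "\<not> ?thesis"
  then have none: "\<epsilon> < norm (manppa_dir Y t (x k))" if "int k \<le> \<lceil>B\<rceil>" for k
    using that sph unfolding B_def eps_stationary_point_def by (meson not_le)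
  \<comment> \<open>Nonnegativity ensures that \<open>nat\<close> does not truncate the
    ceiling.\<close>
  have "0 \<le> B"
    using assms optimal_value_le[OF sph, of Y 0] by (simp add: B_def)
  then have m: "int m = \<lceil>B\<rceil>" by (simp add: m_def)
  \<comment> \<open>The indices from \<open>0\<close> to \<open>m\<close> all lie within the bound,
    so there are \<open>m + 1\<close> long directions. This extra one yields
    \<open>m + 1 \<le> B \<le> m\<close>, a contradiction even though the estimates are not
    strict.\<close>
  have "real (Suc m) * \<epsilon>\<^sup>2 = (\<Sum>k<Suc m. \<epsilon>\<^sup>2)" by simp
  also have "\<dots> \<le> (\<Sum>k<Suc m. (norm (manppa_dir Y t (x k)))\<^sup>2)"
    using assms(3) m by (intro sum_mono power_mono less_imp_le[OF none]) auto
  also have "\<dots> \<le> 2 * t * (objective Y (x 0) - objective Y (x (Suc m)))"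
    using manppa_sequence_sum_le[OF assms(1,2), of "Suc m"] assms(1)
    by (simp add: pos_divide_le_eq mult.commute)
  also have "\<dots> \<le> 2 * t * (objective Y (x 0) - optimal_value Y)"
    using optimal_value_le[OF sph, of Y "Suc m"] assms(1) by (intro mult_left_mono) auto
  finally have "real (Suc m) \<le> B"
    using assms(3) by (simp add: B_def pos_le_divide_eq)
  moreover have "B \<le> real m" by (simp add: m_def real_nat_ceiling_ge)
  ultimately show False by simp
qed

theorem theorem2p2:
  fixes Y :: "real ^ 'p ^ 'n" and \<beta> t :: real and x :: "nat \<Rightarrow> real ^ 'n"
  assumes "0 < \<beta>" "\<beta> < 1" and "0 < t"
    and "manppa_sequence Y \<beta> t x"
  shows "(\<forall>l. sequence_limit_point x l \<longrightarrow> stationary_point Y l) \<and>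
    (\<forall>L>0. L-lipschitz_on UNIV (objective Y) \<longrightarrow> t = 1 / L \<longrightarrow>
       (\<forall>\<epsilon>>0. \<exists>k. int k \<le> \<lceil>2 * (objective Y (x 0) - optimal_value Y) / (L * \<epsilon>\<^sup>2)\<rceil> \<and>
                  eps_stationary_point Y t \<epsilon> (x k)))"
proof (intro conjI allI impI)
  fix l assume "sequence_limit_point x l"
  then show "stationary_point Y l" by (rule limit_point_stationary[OF assms(3,4)])
next
  fix L \<epsilon> :: real
  assume "0 < L" "t = 1 / L" "0 < \<epsilon>"
  \<comment> \<open>With \<open>t = 1 / L\<close> the factor \<open>2 * t\<close> of the general
    bound becomes \<open>2 / L\<close>.\<close>
  then show "\<exists>k. int k \<le> \<lceil>2 * (objective Y (x 0) - optimal_value Y) / (L * \<epsilon>\<^sup>2)\<rceil> \<and>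
      eps_stationary_point Y t \<epsilon> (x k)"
    using ex_eps_stationary_point[OF assms(3,4), of \<epsilon>] by simp
qed

end
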